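(* For each order $n$, the index $KII$ is bounded from above on the set $M_R$ of reciprocal matrices of order $n$: there exists $K\in\mathbb{R}$ such that $KII(A)\le K$ for all $A\in M_R$.
   Context: $M_R$ is the set of all real $n\times n$ matrices $A=(a_{ij})$ with $a_{ij}>0$ for all $i,j$ and $a_{ij}=1/a_{ji}$ for all $i,j$ (reciprocal matrices). Koczkodaj's inconsistency index of $A\in M_R$ is $$KII(A)=\max_{i,j,k\in\{1,\dots,n\}}\ \min\left(\left|1-\frac{a_{ik}}{a_{ij}a_{jk}}\right|,\ \left|1-\frac{a_{ij}a_{jk}}{a_{ik}}\right|\right).$$ *)

theory Defs
  imports "HOL-Analysis.Finite_Cartesian_Product"
begin

definition reciprocal_matrices :: "(real ^ 'n ^ 'n) set" where
  "reciprocal_matrices =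
     {A. (\<forall>i j. A $ i $ j > 0) \<and> (\<forall>i j. A $ i $ j = 1 / A $ j $ i)}"

text \<open>The set under the maximum is finite and nonempty, the index type being so.\<close>

definition KII :: "real ^ 'n ^ 'n \<Rightarrow> real" where
  "KII A = Max {min \<bar>1 - A $ i $ k / (A $ i $ j * A $ j $ k)\<bar>
                    \<bar>1 - A $ i $ j * A $ j $ k / A $ i $ k\<bar> | i j k. True}"

end

theory Submission
  imports Defs
begin

text \<open>The two arguments of the minimum are $|1 - x|$ and $|1 - 1/x|$ with $x > 0$. One of $x$, $1/x$
  lies in $(0, 1]$, so every term of the maximum is at most 1, whatever the order of the matrix.\<close>

lemma min_abs_one_minus_inverse_le_one:
  fixes x :: real
  assumes "x > 0"
  shows "min \<bar>1 - x\<bar> \<bar>1 - inverse x\<bar> \<le> 1"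
proof (cases "x \<le> 1")
  case True
  with assms show ?thesis by auto
next
  case False
  \<comment> \<open>Here the second argument of the minimum is \<open>1 - inverse x\<close>, which
    lies in [0, 1).\<close>
  then have "0 < inverse x" "inverse x \<le> 1"
    by (auto simp: inverse_le_1_iff)
  then show ?thesis by linarith
qed

lemma KII_le_one:
  fixes A :: "real ^ 'n ^ 'n"
  assumes "\<And>i j. A $ i $ j > 0"
  shows "KII A \<le> 1"
proof -
  \<comment> \<open>Indexing the terms by a single triple turns the set under \<open>Max\<close>
    into the range of a function on a finite type, hence a finite nonempty set.\<close>
  define f where "f = (\<lambda>(i, j, k). min \<bar>1 - A $ i $ k / (A $ i $ j * A $ j $ k)\<bar>
                                       \<bar>1 - A $ i $ j * A $ j $ k / A $ i $ k\<bar>)"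
  have "f t \<le> 1" for t
  proof -
    obtain i j k where t: "t = (i, j, k)"
      by (cases t)
    have "A $ i $ k / (A $ i $ j * A $ j $ k) > 0"
      using assms by simp
    \<comment> \<open>The inverse of this quotient is the fraction in the second argument of the
      minimum.\<close>
    from min_abs_one_minus_inverse_le_one[OF this] show ?thesis
      by (simp add: t f_def)
  qed
  moreover have "KII A = Max (range f)"
    unfolding KII_def f_def by (rule arg_cong[where f = Max]) (auto simp: image_iff, blast)
  ultimately show ?thesis
    by (simp add: image_subset_iff)
qed

theorem proposition17:
  shows "\<exists>K::real. \<forall>A \<in> (reciprocal_matrices :: (real ^ 'n ^ 'n) set). KII A \<le> K"
  using KII_le_one unfolding reciprocal_matrices_def by blast

end
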